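(* Assume $\kappa=\kappa^{<\kappa}$. For every $x\in S_\kappa$, the Stone–Čech remainder $(S_\kappa\setminus\{x\})^*$ contains a family of $2^\kappa$ many pairwise disjoint non-empty clopen sets.
   Context: A space is zero-dimensional if it has a base of clopen sets. For a zero-dimensional space $X$ and an open $U\subseteq X$, the ($X$-)type $\tau(U)$ is the least cardinal $\tau$ such that $U$ is a union of $\tau$ many clopen subsets of $X$. A zero-dimensional space is an $F_\kappa$-space if every open subset of type less than $\kappa$ is $C^*$-embedded (every bounded continuous real-valued function on it extends continuously to the whole space). A space is a $G_\kappa$-space if every non-empty intersection of fewer than $\kappa$ open sets has non-empty interior. A $\kappa$-Parovičenko space is a compact Hausdorff zero-dimensional $F_\kappa$- and $G_\kappa$-space without isolated points (no weight restriction is imposed). If $\kappa=\kappa^{<\kappa}$ there is, up to homeomorphism, a unique $\kappa$-Parovičenko space of weight $\kappa$; it is denoted $S_\kappa$. For a Tychonoff space $X$, $X^*=\beta X\setminus X$. *)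

theory Defs
  imports "HOL-Analysis.Analysis" "HOL-Library.Equipollence"
begin

definition is_base :: "'a topology \<Rightarrow> 'a set set \<Rightarrow> bool" where
  "is_base X \<B> \<longleftrightarrow> (\<forall>B\<in>\<B>. openin X B) \<and>
     (\<forall>U. openin X U \<longrightarrow> (\<exists>\<C>. \<C> \<subseteq> \<B> \<and> \<Union>\<C> = U))"

definition zero_dim :: "'a topology \<Rightarrow> bool" where
  "zero_dim X \<longleftrightarrow> (\<exists>\<B>. is_base X \<B> \<and> (\<forall>B\<in>\<B>. closedin X B))"

definition weight_eq :: "'a topology \<Rightarrow> 'k set \<Rightarrow> bool" where
  "weight_eq X K \<longleftrightarrow> (\<exists>\<B>. is_base X \<B> \<and> \<B> \<approx> K) \<and> (\<forall>\<B>. is_base X \<B> \<longrightarrow> K \<lesssim> \<B>)"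

definition type_less :: "'a topology \<Rightarrow> 'a set \<Rightarrow> 'k set \<Rightarrow> bool" where
  "type_less X U K \<longleftrightarrow> (\<exists>\<C>. \<C> \<prec> K \<and> (\<forall>C\<in>\<C>. openin X C \<and> closedin X C) \<and> \<Union>\<C> = U)"

definition C_star_embedded :: "'a topology \<Rightarrow> 'a set \<Rightarrow> bool" where
  "C_star_embedded X U \<longleftrightarrow>
     (\<forall>f. continuous_map (subtopology X U) euclideanreal f \<and> bounded (f ` (topspace X \<inter> U)) \<longrightarrow>
        (\<exists>g. continuous_map X euclideanreal g \<and> (\<forall>u\<in>topspace X \<inter> U. g u = f u)))"

definition F_space :: "'k set \<Rightarrow> 'a topology \<Rightarrow> bool" where
  "F_space K X \<longleftrightarrow> zero_dim X \<and>
     (\<forall>U. openin X U \<and> type_less X U K \<longrightarrow> C_star_embedded X U)"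

definition G_space :: "'k set \<Rightarrow> 'a topology \<Rightarrow> bool" where
  "G_space K X \<longleftrightarrow>
     (\<forall>\<U>. \<U> \<prec> K \<and> (\<forall>U\<in>\<U>. openin X U) \<and> topspace X \<inter> \<Inter>\<U> \<noteq> {} \<longrightarrow>
        X interior_of (topspace X \<inter> \<Inter>\<U>) \<noteq> {})"

definition no_isolated_points :: "'a topology \<Rightarrow> bool" where
  "no_isolated_points X \<longleftrightarrow> (\<forall>x\<in>topspace X. \<not> openin X {x})"

definition parovicenko :: "'k set \<Rightarrow> 'a topology \<Rightarrow> bool" where
  "parovicenko K X \<longleftrightarrow> compact_space X \<and> Hausdorff_space X \<and> zero_dim X \<and>
     F_space K X \<and> G_space K X \<and> no_isolated_points X"

text \<open>kappa = kappa^{<kappa}: kappa^lambda \<le> kappa for every cardinal lambda < kappa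
  (the inequality kappa \<le> kappa^{<kappa} always holds).\<close>
definition kappa_eq_kappa_less_kappa :: "'k set \<Rightarrow> bool" where
  "kappa_eq_kappa_less_kappa K \<longleftrightarrow> (\<forall>A. A \<subseteq> K \<and> A \<prec> K \<longrightarrow> (A \<rightarrow>\<^sub>E K) \<lesssim> K)"

definition stone_cech :: "'a topology \<Rightarrow> 'b topology \<Rightarrow> ('a \<Rightarrow> 'b) \<Rightarrow> bool" where
  "stone_cech X Y e \<longleftrightarrow> compact_space Y \<and> Hausdorff_space Y \<and> embedding_map X Y e \<and>
     Y closure_of (e ` topspace X) = topspace Y \<and>
     (\<forall>f. continuous_map X euclideanreal f \<and> bounded (f ` topspace X) \<longrightarrow>
        (\<exists>g. continuous_map Y euclideanreal g \<and> (\<forall>x\<in>topspace X. g (e x) = f x)))"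

definition remainder :: "'a topology \<Rightarrow> 'b topology \<Rightarrow> ('a \<Rightarrow> 'b) \<Rightarrow> 'b topology" where
  "remainder X Y e = subtopology Y (topspace Y - e ` topspace X)"

end

theory Submission
  imports Defs
begin

text \<open>Write S - {x} as an increasing union of open sets of type less than kappa. Along the branches of
  the binary tree of height kappa, build increasing compact clopen sets missing x, whose new
  parts are disjoint from everything previously attached to incomparable nodes. Since kappa^{<kappa} = kappa, the nodes can
  be enumerated in order type kappa compatibly with the tree order, so that at every step fewer than
  kappa clopen sets have to be respected; the F-space property separates what must be
  included from what must be avoided, and the G-space property leaves room for something new. The
  only danger is that x enters the closure at a limit step. If some open V of type less than kappa
  accumulates at x, everything is kept disjoint from V, and disjoint open sets of type less than
  kappa have disjoint closures; if there is no such V, nothing can go wrong. The unions along the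
  2^kappa branches are clopen in S - {x}, not compact, and pairwise almost disjoint, so their closures in
  the Stone-Cech compactification trace disjoint non-empty clopen sets on the remainder.\<close>

subsection \<open>Small sets and the coded tree\<close>

lemma lepoll_iff_ordLeq: "A \<lesssim> B \<longleftrightarrow> ordLeq3 (card_of A) (card_of B)"
  by (simp add: card_of_ordLeq lepoll_def)

lemma lesspoll_iff_ordLess: "A \<prec> B \<longleftrightarrow> ordLess2 (card_of A) (card_of B)"
proof -
  have "A \<lesssim> B \<or> B \<lesssim> A"
    unfolding lepoll_iff_ordLeq by (rule ordLeq_total[OF card_of_Well_order card_of_Well_order])
  then have "A \<prec> B \<longleftrightarrow> \<not> B \<lesssim> A"
    using lepoll_antisym[of A B] eqpoll_imp_lepoll[OF eqpoll_sym, of A B] by (auto simp: lesspoll_def)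
  also have "\<dots> \<longleftrightarrow> ordLess2 (card_of A) (card_of B)"
    unfolding lepoll_def by (rule card_of_ordLess)
  finally show ?thesis .
qed

lemma Un_lesspoll_infinite: "\<lbrakk>infinite C; A \<prec> C; B \<prec> C\<rbrakk> \<Longrightarrow> A \<union> B \<prec> C"
  by (simp add: lesspoll_iff_ordLess card_of_Un_ordLess_infinite)

lemma Sigma_lepoll_infinite: "\<lbrakk>infinite C; A \<lesssim> C; \<And>a. a \<in> A \<Longrightarrow> B a \<lesssim> C\<rbrakk> \<Longrightarrow> Sigma A B \<lesssim> C"
  by (simp add: lepoll_iff_ordLeq card_of_Sigma_ordLeq_infinite)

lemma image_lesspoll: "A \<prec> C \<Longrightarrow> f ` A \<prec> C"
  by (rule lesspoll_trans1[OF image_lepoll])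

lemma subset_lesspoll: "\<lbrakk>A \<prec> C; B \<subseteq> A\<rbrakk> \<Longrightarrow> B \<prec> C"
  by (rule lesspoll_trans1[OF subset_imp_lepoll])

text \<open>The product lies in the square of the union of the two factors. That union is still
  small, and its square is finite or no larger than the union itself.\<close>

lemma Times_lesspoll_infinite:
  fixes A B :: "'a set"
  assumes C: "infinite C" "A \<prec> C" "B \<prec> C"
  shows "A \<times> B \<prec> C"
proof -
  define W where "W = A \<union> B"
  have W: "W \<prec> C"
    unfolding W_def by (rule Un_lesspoll_infinite[OF C])
  have "W \<times> W \<prec> C"
  proof (cases "finite W")
    case True
    then have "finite (W \<times> W)"
      by (rule finite_cartesian_product[OF _ True])
    then show ?thesis
      by (rule finite_lesspoll_infinite[OF C(1)])
  next
    case False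
    have "W \<times> W \<lesssim> W"
      by (rule Sigma_lepoll_infinite[OF False lepoll_refl lepoll_refl])
    then show ?thesis
      using W by (rule lesspoll_trans1)
  qed
  moreover have "A \<times> B \<subseteq> W \<times> W"
    unfolding W_def by (intro Sigma_mono Un_upper1 Un_upper2)
  ultimately show ?thesis
    by (rule subset_lesspoll)
qed

text \<open>\<open>R\<close> is the strict form of a well-order of \<open>K\<close> in the type of
  an initial ordinal, so elements of \<open>K\<close> play the ordinals below kappa and being small
  means having cardinality less than kappa.\<close>

locale initial_order =
  fixes K :: "'k set" and R :: "'k rel"
  assumes infinite_K: "infinite K"
    and wf_R: "wf R" and trans_R: "trans R"
    and total_R: "\<lbrakk>a \<in> K; b \<in> K; a \<noteq> b\<rbrakk> \<Longrightarrow> (a, b) \<in> R \<or> (b, a) \<in> R"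
    and R_sub: "R \<subseteq> K \<times> K"
    and small_R: "a \<in> K \<Longrightarrow> {b. (b, a) \<in> R} \<prec> K"
begin

lemma R_trans: "\<lbrakk>(a, b) \<in> R; (b, c) \<in> R\<rbrakk> \<Longrightarrow> (a, c) \<in> R"
  using trans_R by (meson transD)

lemma R_in_K: "(a, b) \<in> R \<Longrightarrow> a \<in> K" "(a, b) \<in> R \<Longrightarrow> b \<in> K"
  using R_sub by auto

lemma small_Req: "a \<in> K \<Longrightarrow> insert a {b. (b, a) \<in> R} \<prec> K"
  using Un_lesspoll_infinite[OF infinite_K finite_lesspoll_infinite[OF infinite_K, of "{a}"] small_R]
  by simp

end

lemma initial_order_exists:
  assumes "infinite (K :: 'k set)"
  shows "\<exists>R. initial_order K R"
proof -
  define R where "R = card_of K - Id"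
  have W: "well_order_on K (card_of K)"
    by (rule card_of_well_order_on)
  then have L: "linear_order_on K (card_of K)" and wf: "wf R"
    unfolding well_order_on_def R_def by auto
  have "initial_order K R"
  proof
    show "infinite K" "wf R" by fact+
    show "trans R"
      using L unfolding R_def linear_order_on_def partial_order_on_def preorder_on_def
      by (meson trans_diff_Id)
    show "\<And>a b. \<lbrakk>a \<in> K; b \<in> K; a \<noteq> b\<rbrakk> \<Longrightarrow> (a, b) \<in> R \<or> (b, a) \<in> R"
      using L unfolding R_def linear_order_on_def total_on_def by blast
    show "R \<subseteq> K \<times> K"
      using L unfolding R_def linear_order_on_def partial_order_on_def preorder_on_def
      by blast
    show "{b. (b, a) \<in> R} \<prec> K" if "a \<in> K" for a
    proof -
      have "underS (card_of K) a = {b. (b, a) \<in> R}"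
        unfolding underS_def R_def by auto
      then show ?thesis
        using card_of_underS[OF card_of_Card_order, of a K] that
        by (simp add: lesspoll_iff_ordLess Field_card_of)
    qed
  qed
  then show ?thesis ..
qed

section \<open>Consequences of kappa = kappa^{<kappa}\<close>

context initial_order
begin

text \<open>Koenig's diagonal argument: an unbounded small set C would give more than K functions
  from C to K.\<close>

lemma small_bounded:
  assumes K: "kappa_eq_kappa_less_kappa K" and C: "C \<subseteq> K" "C \<prec> K"
  shows "\<exists>b\<in>K. \<forall>c\<in>C. (c, b) \<in> R"
proof (rule ccontr)
  assume unb: "\<not> ?thesis"
  obtain i where i: "inj_on i (C \<rightarrow>\<^sub>E K)" "i ` (C \<rightarrow>\<^sub>E K) \<subseteq> K"
    using K C unfolding kappa_eq_kappa_less_kappa_def lepoll_def by blast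
  \<comment> \<open>\<open>V c\<close> collects the values at \<open>c\<close> of all functions
    whose index under \<open>i\<close> is at most \<open>c\<close>. There are fewer than
    \<open>K\<close> such functions, so some element of \<open>K\<close> is missed and can serve as
    diagonal value.\<close>
  define V where "V c = (\<lambda>F. F c) ` {F \<in> C \<rightarrow>\<^sub>E K. i F \<in> insert c {b. (b, c) \<in> R}}" for c
  have "\<exists>y\<in>K. y \<notin> V c" if c: "c \<in> C" for c
  proof -
    have "{F \<in> C \<rightarrow>\<^sub>E K. i F \<in> insert c {b. (b, c) \<in> R}} \<lesssim> insert c {b. (b, c) \<in> R}"
      unfolding lepoll_def by (rule exI[of _ i]) (use i(1) in \<open>auto simp: inj_on_def\<close>)
    then have "V c \<prec> K"
      unfolding V_def using image_lepoll lepoll_trans lesspoll_trans1 small_Req c C(1)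
      by (meson subsetD)
    then show ?thesis
      by (metis lesspoll_not_refl subset_lesspoll subsetI)
  qed
  then obtain y where y: "\<And>c. c \<in> C \<Longrightarrow> y c \<in> K \<and> y c \<notin> V c"
    by metis
  define g where "g = restrict y C"
  have g: "g \<in> C \<rightarrow>\<^sub>E K"
    unfolding g_def using y by auto
  \<comment> \<open>As \<open>C\<close> is unbounded, some \<open>c\<close> in it is not below the
    index of the diagonal function \<open>g\<close>. Then \<open>g\<close> itself is among the
    functions that \<open>g c\<close> was chosen to avoid.\<close>
  obtain c where c: "c \<in> C" "(c, i g) \<notin> R"
    using unb i(2) g by blast
  then have "i g \<in> insert c {b. (b, c) \<in> R}"
    using total_R[of c "i g"] i(2) g C(1) by blast
  then have "g c \<in> V c"
    unfolding V_def using g by blast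
  then show False
    using y[OF c(1)] c(1) by (simp add: g_def)
qed

text \<open>A node at level \<open>a\<close> is a set of predecessors of \<open>a\<close>.
  Characteristic functions with two values in \<open>K\<close> inject these sets into a function
  space bounded by the cardinal hypothesis. The extra factor \<open>K\<close> gives every node a
  whole block of candidate codes.\<close>

lemma node_codes:
  assumes K: "kappa_eq_kappa_less_kappa K"
  shows "(Sigma K (\<lambda>a. Pow {b. (b, a) \<in> R})) \<times> K \<lesssim> K"
proof -
  obtain k0 k1 where k: "k0 \<in> K" "k1 \<in> K" "k0 \<noteq> k1"
  proof -
    obtain k0 where k0: "k0 \<in> K"
      using infinite_K by fastforce
    have "infinite (K - {k0})"
      using infinite_K by simp
    then have "K - {k0} \<noteq> {}"
      by (rule infinite_imp_nonempty)
    then obtain k1 where "k1 \<in> K - {k0}"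
      by blast
    then show ?thesis
      using that k0 by blast
  qed
  have P: "Pow {b. (b, a) \<in> R} \<lesssim> K" if a: "a \<in> K" for a
  proof -
    let ?I = "{b. (b, a) \<in> R}"
    let ?h = "\<lambda>s. \<lambda>u\<in>?I. if u \<in> s then k0 else k1"
    have "inj_on ?h (Pow ?I)"
    proof (rule inj_onI)
      fix s t assume st: "s \<in> Pow ?I" "t \<in> Pow ?I" and eq: "?h s = ?h t"
      have "u \<in> s \<longleftrightarrow> u \<in> t" if "u \<in> ?I" for u
        using fun_cong[OF eq, of u] that k(3) by (auto split: if_splits)
      then show "s = t" using st by blast
    qed
    moreover have "?h ` Pow ?I \<subseteq> ?I \<rightarrow>\<^sub>E K"
      using k by (intro image_subsetI PiE_I) simp_all
    ultimately have "Pow ?I \<lesssim> ?I \<rightarrow>\<^sub>E K"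
      unfolding lepoll_def by (intro exI conjI)
    also have "?I \<rightarrow>\<^sub>E K \<lesssim> K"
    proof -
      have "?I \<subseteq> K"
        using R_in_K(1) by blast
      then show ?thesis
        using K small_R[OF a] by (simp add: kappa_eq_kappa_less_kappa_def)
    qed
    finally show ?thesis .
  qed
  show ?thesis
    using infinite_K
  proof (rule Sigma_lepoll_infinite)
    show "Sigma K (\<lambda>a. Pow {b. (b, a) \<in> R}) \<lesssim> K"
      by (rule Sigma_lepoll_infinite[OF infinite_K lepoll_refl P])
  qed (rule lepoll_refl)
qed

end

text \<open>The nodes of the binary tree of height K are coded injectively by elements of K so that
  codes increase along branches; e f a is the code of the restriction of f to the predecessors of a.\<close>

locale coded_tree = initial_order +
  fixes e :: "'a set \<Rightarrow> 'a \<Rightarrow> 'a"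
  assumes code_in_K: "a \<in> K \<Longrightarrow> e f a \<in> K"
    and code_mono: "(a, b) \<in> R \<Longrightarrow> (e f a, e f b) \<in> R"
    and code_eqD: "\<lbrakk>a \<in> K; b \<in> K; e f a = e g b\<rbrakk> \<Longrightarrow> a = b \<and> (\<forall>c. (c, a) \<in> R \<longrightarrow> (c \<in> f \<longleftrightarrow> c \<in> g))"
    and code_cong: "(\<And>c. (c, a) \<in> R \<Longrightarrow> c \<in> f \<longleftrightarrow> c \<in> g) \<Longrightarrow> e f a = e g a"

section \<open>Construction of the coding\<close>

context initial_order
begin

text \<open>Codes are chosen by recursion on the level. The injection \<open>D\<close> gives
  distinct nodes disjoint blocks of \<open>K\<close> many candidates, which makes the coding
  injective. The codes of the predecessors of a node form a small set, hence are bounded, and a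
  block of size \<open>K\<close> has a member above the bound.\<close>

lemma coded_tree_exists:
  assumes K: "kappa_eq_kappa_less_kappa K"
  shows "\<exists>e. coded_tree K R e"
proof -
  let ?I = "\<lambda>a. {b. (b, a) \<in> R}"
  obtain D where D: "inj_on D ((Sigma K (\<lambda>a. Pow (?I a))) \<times> K)"
      "D ` ((Sigma K (\<lambda>a. Pow (?I a))) \<times> K) \<subseteq> K"
    using node_codes[OF K] unfolding lepoll_def by meson
  \<comment> \<open>The recursion runs over pairs of a level and a set. The set is cut down to the
    predecessors of the level, so that only the node matters, and \<open>h\<close> is consulted at
    lower levels only.\<close>
  define P where "P h p \<theta> \<longleftrightarrow> (fst p \<in> K \<longrightarrow> \<theta> \<in> K \<and> (\<exists>k\<in>K. \<theta> = D ((fst p, snd p \<inter> ?I (fst p)), k)) \<and>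
      (\<forall>b. (b, fst p) \<in> R \<longrightarrow> (h (b, snd p \<inter> ?I b), \<theta>) \<in> R))" for h :: "'k \<times> 'k set \<Rightarrow> 'k" and p \<theta>
  have "\<exists>h. \<forall>p. P h p (h p)"
  proof (rule dependent_wf_choice[where R = "inv_image R fst"])
    show "wf (inv_image R fst)"
      by (simp add: wf_R)
    show "P h p \<theta> = P h' p \<theta>" if "\<And>z. (z, p) \<in> inv_image R fst \<Longrightarrow> h z = h' z" for h h' p \<theta>
      unfolding P_def using that by simp
    show "\<exists>\<theta>. P h p \<theta>" if prev: "\<And>z. (z, p) \<in> inv_image R fst \<Longrightarrow> P h z (h z)" for h p
    proof (cases "fst p \<in> K")
      case True
      let ?s = "snd p" and ?a = "fst p"
      let ?C = "(\<lambda>b. h (b, ?s \<inter> ?I b)) ` ?I ?a"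
      have "?C \<subseteq> K"
      proof clarify
        fix b assume b: "(b, ?a) \<in> R"
        show "h (b, ?s \<inter> ?I b) \<in> K"
          using prev[of "(b, ?s \<inter> ?I b)"] b R_in_K(1)[OF b] unfolding P_def by simp
      qed
      moreover have "?C \<prec> K"
        by (rule image_lesspoll[OF small_R[OF True]])
      ultimately obtain c where c: "c \<in> K" "\<forall>y\<in>?C. (y, c) \<in> R"
        using small_bounded[OF K] by blast
      \<comment> \<open>The block of the current node; it is too large to fit into the initial
        segment up to the bound \<open>c\<close>.\<close>
      let ?d = "\<lambda>k. D ((?a, ?s \<inter> ?I ?a), k)"
      have "inj_on ?d K"
        by (rule inj_onI, drule inj_onD[OF D(1)]) (use True in auto)
      then have "\<not> ?d ` K \<subseteq> insert c (?I c)"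
        using subset_lesspoll[OF small_Req[OF c(1)], of "?d ` K"] inj_on_image_lesspoll_1[of ?d K K]
        by (metis lesspoll_not_refl)
      then obtain k where k: "k \<in> K" "?d k \<notin> insert c (?I c)"
        unfolding image_subset_iff by meson
      have dK: "?d k \<in> K"
        by (rule subsetD[OF D(2) imageI]) (use True k(1) in auto)
      then have "(c, ?d k) \<in> R"
        using total_R[of c "?d k"] k(2) c(1) by blast
      then have "P h p (?d k)"
        unfolding P_def
      proof (intro impI conjI allI)
        show "?d k \<in> K" by (fact dK)
        show "\<exists>k'\<in>K. ?d k = ?d k'" using k(1) by blast
        fix b assume "(b, ?a) \<in> R"
        then have "(h (b, ?s \<inter> ?I b), c) \<in> R" using c(2) by blast
        then show "(h (b, ?s \<inter> ?I b), ?d k) \<in> R"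
          using \<open>(c, ?d k) \<in> R\<close> by (rule R_trans)
      qed
      then show ?thesis ..
    qed (simp add: P_def)
  qed
  then obtain h where h: "\<And>p. P h p (h p)"
    by blast
  define e where "e f a = h (a, f \<inter> ?I a)" for f a
  have code: "\<exists>k\<in>K. e f a = D ((a, f \<inter> ?I a), k)" if "a \<in> K" for f a
    using h[of "(a, f \<inter> ?I a)"] that unfolding P_def e_def by (simp add: Int_assoc)
  have "coded_tree K R e"
  proof
    show "e f a \<in> K" if "a \<in> K" for f a
      using h[of "(a, f \<inter> ?I a)"] that unfolding P_def e_def by simp
    show "(e f a, e f b) \<in> R" if ab: "(a, b) \<in> R" for f a b
    proof -
      have "f \<inter> ?I b \<inter> ?I a = f \<inter> ?I a"
        using R_trans[OF _ ab] by blast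
      moreover have "(h (a, f \<inter> ?I b \<inter> ?I a), h (b, f \<inter> ?I b)) \<in> R"
        using h[of "(b, f \<inter> ?I b)"] ab R_in_K[OF ab] unfolding P_def by simp
      ultimately show ?thesis
        by (simp add: e_def)
    qed
    show "a = b \<and> (\<forall>c. (c, a) \<in> R \<longrightarrow> (c \<in> f \<longleftrightarrow> c \<in> g))"
      if ab: "a \<in> K" "b \<in> K" "e f a = e g b" for f g a b
    proof -
      obtain k l where kl: "k \<in> K" "l \<in> K" "D ((a, f \<inter> ?I a), k) = D ((b, g \<inter> ?I b), l)"
        using code[OF ab(1), of f] code[OF ab(2), of g] ab(3) by auto
      have "((a, f \<inter> ?I a), k) = ((b, g \<inter> ?I b), l)"
        by (rule inj_onD[OF D(1) kl(3)]) (use ab(1,2) kl(1,2) in simp_all)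
      then have "a = b" and "f \<inter> ?I a = g \<inter> ?I b"
        unfolding prod.inject by (rule conjunct1[OF conjunct1], rule conjunct2[OF conjunct1])
      then show ?thesis by blast
    qed
    show "e f a = e g a" if "\<And>c. (c, a) \<in> R \<Longrightarrow> c \<in> f \<longleftrightarrow> c \<in> g" for f g a
    proof -
      have "f \<inter> ?I a = g \<inter> ?I a"
        using that by blast
      then show ?thesis
        by (simp add: e_def)
    qed
  qed
  then show ?thesis
    by (rule exI[of _ e])
qed

end

subsection \<open>Separation in zero-dimensional spaces\<close>

definition clopenin :: "'a topology \<Rightarrow> 'a set \<Rightarrow> bool" where
  "clopenin X U \<longleftrightarrow> openin X U \<and> closedin X U"

lemma clopenin_empty [simp]: "clopenin X {}"
  by (simp add: clopenin_def)

lemma clopenin_Un: "\<lbrakk>clopenin X U; clopenin X V\<rbrakk> \<Longrightarrow> clopenin X (U \<union> V)"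
  by (auto simp: clopenin_def)

lemma clopenin_Diff: "\<lbrakk>clopenin X U; clopenin X V\<rbrakk> \<Longrightarrow> clopenin X (U - V)"
  by (auto simp: clopenin_def openin_diff closedin_diff)

lemma clopenin_Union_finite: "\<lbrakk>finite \<U>; \<And>U. U \<in> \<U> \<Longrightarrow> clopenin X U\<rbrakk> \<Longrightarrow> clopenin X (\<Union>\<U>)"
  unfolding clopenin_def by (simp add: closedin_Union openin_Union)

lemma type_less_iff: "type_less X U K \<longleftrightarrow> (\<exists>\<C>. \<C> \<prec> K \<and> (\<forall>C\<in>\<C>. clopenin X C) \<and> \<Union>\<C> = U)"
  by (simp add: type_less_def clopenin_def)

lemma type_less_UN: "\<lbrakk>I \<prec> K; \<And>i. i \<in> I \<Longrightarrow> clopenin X (F i)\<rbrakk> \<Longrightarrow> type_less X (\<Union>i\<in>I. F i) K"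
  unfolding type_less_iff by (rule exI[of _ "F ` I"]) (auto simp: image_lesspoll)

lemma type_less_Un:
  assumes "infinite K" "type_less X U K" "type_less X V K" shows "type_less X (U \<union> V) K"
proof -
  obtain \<C> \<D> where "\<C> \<prec> K" "\<forall>C\<in>\<C>. clopenin X C" "\<Union>\<C> = U" "\<D> \<prec> K" "\<forall>C\<in>\<D>. clopenin X C" "\<Union>\<D> = V"
    using assms(2,3) unfolding type_less_iff by blast
  then show ?thesis
    unfolding type_less_iff
    by (intro exI[of _ "\<C> \<union> \<D>"]) (auto simp: Un_lesspoll_infinite assms(1))
qed

lemma type_less_empty: "infinite K \<Longrightarrow> type_less X {} K"
  unfolding type_less_iff by (rule exI[of _ "{}"]) (simp add: finite_lesspoll_infinite)

lemma openin_type_less: "type_less X U K \<Longrightarrow> openin X U"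
  unfolding type_less_def by (auto intro: openin_Union)

lemma zero_dim_clopenin:
  assumes "zero_dim X" "openin X U" "p \<in> U"
  obtains C where "clopenin X C" "p \<in> C" "C \<subseteq> U"
proof -
  obtain \<B> where \<B>: "is_base X \<B>" "\<forall>B\<in>\<B>. closedin X B"
    using assms(1) by (auto simp: zero_dim_def)
  obtain \<C> where \<C>: "\<C> \<subseteq> \<B>" "\<Union>\<C> = U"
    using \<B>(1) assms(2) by (auto simp: is_base_def)
  then obtain C where C: "C \<in> \<C>" "p \<in> C"
    using assms(3) by blast
  have "C \<in> \<B>" and "C \<subseteq> U"
    using C(1) \<C> by auto
  moreover have "clopenin X C"
    using \<open>C \<in> \<B>\<close> \<B> by (simp add: is_base_def clopenin_def)
  ultimately show ?thesis
    using that C(2) by simp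
qed

lemma compactin_clopenin_nbhd:
  assumes "zero_dim X" "compactin X C" "openin X U" "C \<subseteq> U"
  obtains G where "clopenin X G" "C \<subseteq> G" "G \<subseteq> U"
proof -
  let ?\<U> = "{G. clopenin X G \<and> G \<subseteq> U}"
  have "C \<subseteq> \<Union>?\<U>"
  proof
    fix p assume "p \<in> C"
    then show "p \<in> \<Union>?\<U>"
      using zero_dim_clopenin[OF assms(1,3)] assms(4)
      by (smt (verit) UnionI mem_Collect_eq subsetD)
  qed
  moreover have "\<forall>G\<in>?\<U>. openin X G"
    by (simp add: clopenin_def)
  ultimately obtain \<F> where "finite \<F>" "\<F> \<subseteq> ?\<U>" "C \<subseteq> \<Union>\<F>"
    using assms(2) unfolding compactin_def by (metis (no_types, lifting))
  then show ?thesis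
    using that[of "\<Union>\<F>"] clopenin_Union_finite[of \<F> X] by blast
qed

lemma continuous_map_indicator:
  assumes "clopenin X A"
  shows "continuous_map X euclideanreal (\<lambda>p. if p \<in> A then 1 else 0)"
  unfolding continuous_map_def
proof (intro conjI allI impI)
  fix T :: "real set"
  have *: "{p \<in> topspace X. (if p \<in> A then 1 else 0) \<in> T} =
    (if 1 \<in> T then A else {}) \<union> (if 0 \<in> T then topspace X - A else {})"
    using assms by (auto simp: clopenin_def dest: openin_subset)
  show "openin X {p \<in> topspace X. (if p \<in> A then 1 else 0) \<in> T}"
    unfolding * using assms by (auto simp: clopenin_def)
qed auto

text \<open>The indicator of \<open>A\<close> is continuous on the open set
  \<open>A \<union> Z\<close>, which has small type, and so extends to a real function
  \<open>g\<close> on \<open>X\<close>. Between the compact set where \<open>g\<close> is at least 1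
  and the open set where \<open>g\<close> is positive, zero-dimensionality inserts a clopen
  set.\<close>

lemma F_space_separation:
  assumes K: "infinite K" and X: "compact_space X" "F_space K X"
    and A: "type_less X A K" and Z: "type_less X Z K" and disj: "A \<inter> Z = {}"
  obtains B where "clopenin X B" "A \<subseteq> B" "B \<inter> Z = {}"
proof -
  have op: "openin X A" "openin X Z"
    using A Z by (simp_all add: openin_type_less)
  have "C_star_embedded X (A \<union> Z)"
    using X(2) type_less_Un[OF K A Z] openin_type_less[OF type_less_Un[OF K A Z]]
    by (simp add: F_space_def)
  moreover have "clopenin (subtopology X (A \<union> Z)) A"
    unfolding clopenin_def
  proof
    show "openin (subtopology X (A \<union> Z)) A"
      unfolding openin_subtopology using op(1) by (intro exI[of _ A]) auto
    have "A = (topspace X - Z) \<inter> (A \<union> Z)"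
      using disj openin_subset[OF op(1)] by blast
    then show "closedin (subtopology X (A \<union> Z)) A"
      unfolding closedin_subtopology using closedin_diff[OF closedin_topspace op(2)] by blast
  qed
  then have "continuous_map (subtopology X (A \<union> Z)) euclideanreal (\<lambda>p. if p \<in> A then 1 else 0)"
    by (rule continuous_map_indicator)
  moreover have "bounded ((\<lambda>p. if p \<in> A then 1 else 0 :: real) ` (topspace X \<inter> (A \<union> Z)))"
    by (rule bounded_subset[of "{0, 1}"]) auto
  ultimately obtain g where g: "continuous_map X euclideanreal g"
      "\<And>u. u \<in> topspace X \<inter> (A \<union> Z) \<Longrightarrow> g u = (if u \<in> A then 1 else 0)"
    unfolding C_star_embedded_def by blast
  let ?C = "{p \<in> topspace X. g p \<in> {1..}}" and ?U = "{p \<in> topspace X. g p \<in> {0<..}}"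
  have "compactin X ?C"
    by (rule closedin_compact_space[OF X(1)], rule closedin_continuous_map_preimage[OF g(1)]) simp
  moreover have "openin X ?U"
    by (rule openin_continuous_map_preimage[OF g(1)]) simp
  moreover have "?C \<subseteq> ?U" by auto
  moreover have "zero_dim X"
    using X(2) by (simp add: F_space_def)
  ultimately obtain G where G: "clopenin X G" "?C \<subseteq> G" "G \<subseteq> ?U"
    using compactin_clopenin_nbhd by blast
  have "A \<subseteq> G"
  proof
    fix p assume "p \<in> A"
    then have "p \<in> ?C"
      using g(2)[of p] openin_subset[OF op(1)] by auto
    then show "p \<in> G"
      using G(2) by blast
  qed
  moreover have "G \<inter> Z = {}"
  proof (rule ccontr)
    assume "G \<inter> Z \<noteq> {}"
    then obtain p where p: "p \<in> G" "p \<in> Z"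
      by blast
    then have "p \<in> topspace X \<inter> (A \<union> Z)" "p \<notin> A"
      using openin_subset[OF op(2)] disj by auto
    then show False
      using g(2)[of p] G(3) p(1) by auto
  qed
  ultimately show ?thesis
    using that G(1) by simp
qed

text \<open>The complements of the clopen pieces of \<open>U\<close> are fewer than \<open>K\<close>
  open sets with \<open>x\<close> in common, so the G-space property gives their intersection a
  non-empty interior. This interior is not \<open>{x}\<close> because \<open>x\<close> is not
  isolated, and a clopen set around another point of it will do.\<close>

lemma clopenin_outside_type_less:
  assumes S: "parovicenko K S" and x: "x \<in> topspace S"
    and U: "type_less S U K" "x \<notin> U"
  obtains W where "clopenin S W" "W \<noteq> {}" "x \<notin> W" "W \<inter> U = {}"
proof -
  have zd: "zero_dim S" and G: "G_space K S" and iso: "no_isolated_points S" and H: "Hausdorff_space S"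
    using S by (auto simp: parovicenko_def)
  obtain \<C> where \<C>: "\<C> \<prec> K" "\<forall>C\<in>\<C>. clopenin S C" "\<Union>\<C> = U"
    using U(1) by (auto simp: type_less_iff)
  let ?\<U> = "(\<lambda>C. topspace S - C) ` \<C>"
  let ?I = "S interior_of (topspace S \<inter> \<Inter>?\<U>)"
  have "?\<U> \<prec> K"
    using \<C>(1) by (rule image_lesspoll)
  moreover have "\<forall>U\<in>?\<U>. openin S U"
    using \<C>(2) by (simp add: clopenin_def openin_diff)
  moreover have "x \<in> topspace S \<inter> \<Inter>?\<U>"
    using \<C>(3) x U(2) by auto
  then have "topspace S \<inter> \<Inter>?\<U> \<noteq> {}"
    by (metis empty_iff)
  ultimately have "?I \<noteq> {}"
    using G[unfolded G_space_def, THEN spec[of _ ?\<U>]] by blast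
  then obtain p where p: "p \<in> ?I" by blast
  have I: "openin S ?I"
    by simp
  have "topspace S \<inter> \<Inter>?\<U> \<inter> U = {}"
    using \<C>(3) by auto
  then have IU: "?I \<inter> U = {}"
    using interior_of_subset[of S "topspace S \<inter> \<Inter>?\<U>"] by blast
  have "?I \<noteq> {x}"
  proof
    assume "?I = {x}"
    with I have "openin S {x}"
      by (simp only:)
    then show False
      using iso x by (simp add: no_isolated_points_def)
  qed
  then obtain q where q: "q \<in> ?I" "q \<noteq> x"
    using p by blast
  have "openin S (?I - {x})"
    using I closedin_Hausdorff_singleton[OF H x] by (rule openin_diff)
  moreover have "q \<in> ?I - {x}"
    using q by simp
  ultimately obtain W where W: "clopenin S W" "q \<in> W" "W \<subseteq> ?I - {x}"
    by (rule zero_dim_clopenin[OF zd])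
  show ?thesis
  proof (rule that[OF W(1)])
    show "W \<noteq> {}" "x \<notin> W" "W \<inter> U = {}"
      using W(2,3) IU by auto
  qed
qed

text \<open>This isolates what one step of the tree recursion needs: separation by a clopen set that
  also misses \<open>x\<close> and gains a point outside \<open>A\<close>. The case distinction on
  accumulation at \<open>x\<close> is thereby made once, before the recursion.\<close>

definition separation_guard :: "'a topology \<Rightarrow> 'k set \<Rightarrow> 'a \<Rightarrow> 'a set \<Rightarrow> bool" where
  "separation_guard S K x V \<longleftrightarrow> type_less S V K \<and> x \<notin> V \<and>
     (\<forall>A Z. type_less S A K \<and> type_less S Z K \<and> A \<inter> Z = {} \<and> V \<subseteq> Z \<and> x \<notin> A \<and> x \<notin> Z \<longrightarrow>
       (\<exists>B. clopenin S B \<and> x \<notin> B \<and> A \<subseteq> B \<and> B \<inter> Z = {} \<and> \<not> B \<subseteq> A))"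

text \<open>If some open set V of small type accumulates at x, keeping everything disjoint from V
  keeps it away from x, because disjoint open sets of small type have disjoint closures.
  Otherwise no open set of small type accumulates at x, and V is taken empty.\<close>

lemma separation_guard_exists:
  assumes K: "infinite K" and S: "parovicenko K S" and x: "x \<in> topspace S"
  shows "\<exists>V. separation_guard S K x V"
proof -
  have cpt: "compact_space S" and F: "F_space K S" and zd: "zero_dim S"
    using S by (auto simp: parovicenko_def)
  \<comment> \<open>\<open>V\<close> is an open set of small type accumulating at \<open>x\<close>
    if there is one, and empty otherwise.\<close>
  obtain V where V: "type_less S V K" "x \<notin> V"
    and dich: "x \<in> S closure_of V \<or> (\<forall>U. type_less S U K \<and> x \<notin> U \<longrightarrow> x \<notin> S closure_of U)"
    using type_less_empty[OF K] by (metis empty_iff)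
  have "separation_guard S K x V"
    unfolding separation_guard_def
  proof (intro conjI allI impI V)
    fix A Z assume "type_less S A K \<and> type_less S Z K \<and> A \<inter> Z = {} \<and> V \<subseteq> Z \<and> x \<notin> A \<and> x \<notin> Z"
    then have A: "type_less S A K" and Z: "type_less S Z K" and AZ: "A \<inter> Z = {}"
      and VZ: "V \<subseteq> Z" and xA: "x \<notin> A" and xZ: "x \<notin> Z"
      by simp_all
    obtain B where B: "clopenin S B" "A \<subseteq> B" "B \<inter> Z = {}"
      using F_space_separation[OF K cpt F A Z AZ] .
    have "\<exists>B'. clopenin S B' \<and> x \<notin> B' \<and> A \<subseteq> B' \<and> B' \<inter> Z = {}"
    proof (cases "x \<in> S closure_of V")
      case True
      \<comment> \<open>Otherwise \<open>B\<close> would be a neighbourhood of \<open>x\<close> and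
        meet \<open>V\<close>, although it is disjoint from \<open>Z\<close>, which contains
        \<open>V\<close>.\<close>
      then have "x \<notin> B"
        using B VZ unfolding in_closure_of clopenin_def by blast
      then show ?thesis
        using B by blast
    next
      case False
      \<comment> \<open>Here no open set of small type omitting \<open>x\<close> accumulates at
        \<open>x\<close>, so a clopen neighbourhood of \<open>x\<close> disjoint from
        \<open>A\<close> can be removed from \<open>B\<close>.\<close>
      then have "x \<notin> S closure_of A"
        using dich A xA by blast
      then obtain T where T: "x \<in> T" "openin S T" "T \<inter> A = {}"
        using x unfolding in_closure_of by blast
      obtain G where "clopenin S G" "x \<in> G" "G \<subseteq> T"
        using zero_dim_clopenin[OF zd T(2,1)] .
      then show ?thesis
        using B T(3) clopenin_Diff[of S B G] by blast
    qed
    then obtain B' where B': "clopenin S B'" "x \<notin> B'" "A \<subseteq> B'" "B' \<inter> Z = {}"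
      by blast
    \<comment> \<open>\<open>W\<close> provides the points of the final set that lie outside
      \<open>A\<close>.\<close>
    obtain W where W: "clopenin S W" "W \<noteq> {}" "x \<notin> W" "W \<inter> (A \<union> Z) = {}"
      using clopenin_outside_type_less[OF S x type_less_Un[OF K A Z]] xA xZ by blast
    show "\<exists>B. clopenin S B \<and> x \<notin> B \<and> A \<subseteq> B \<and> B \<inter> Z = {} \<and> \<not> B \<subseteq> A"
      by (rule exI[of _ "B' \<union> W"]) (use B' W in \<open>auto simp: clopenin_Un\<close>)
  qed
  then show ?thesis ..
qed

lemma weight_cover:
  assumes zd: "zero_dim S" and H: "Hausdorff_space S" and w: "weight_eq S K" and x: "x \<in> topspace S"
  shows "\<exists>U. (\<forall>\<eta>\<in>K. clopenin S (U \<eta>) \<and> x \<notin> U \<eta>) \<and> (\<Union>\<eta>\<in>K. U \<eta>) = topspace S - {x}"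
proof -
  obtain \<B> b where \<B>: "is_base S \<B>" and b: "bij_betw b K \<B>"
    using w eqpoll_sym unfolding weight_eq_def eqpoll_def by (metis bij_betw_inv)
  \<comment> \<open>Each member of the base is enlarged to a clopen set missing \<open>x\<close>
    where possible; the default \<open>{}\<close> keeps \<open>U\<close> clopen and away from
    \<open>x\<close> at all other indices. Base members inside clopen sets missing \<open>x\<close>
    already cover every other point.\<close>
  define U where "U \<eta> = (if \<exists>C. clopenin S C \<and> x \<notin> C \<and> b \<eta> \<subseteq> C
      then SOME C. clopenin S C \<and> x \<notin> C \<and> b \<eta> \<subseteq> C else {})" for \<eta>
  have some: "clopenin S (U \<eta>) \<and> x \<notin> U \<eta> \<and> b \<eta> \<subseteq> U \<eta>"
    if "\<exists>C. clopenin S C \<and> x \<notin> C \<and> b \<eta> \<subseteq> C" for \<eta>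
    using someI_ex[OF that] that by (simp add: U_def)
  have cl: "clopenin S (U \<eta>) \<and> x \<notin> U \<eta>" for \<eta>
    using some by (cases "\<exists>C. clopenin S C \<and> x \<notin> C \<and> b \<eta> \<subseteq> C") (blast, simp add: U_def)
  have "p \<in> (\<Union>\<eta>\<in>K. U \<eta>)" if p: "p \<in> topspace S - {x}" for p
  proof -
    have "openin S (topspace S - {x})"
      using closedin_Hausdorff_singleton[OF H x] by blast
    then obtain C where C: "clopenin S C" "p \<in> C" "C \<subseteq> topspace S - {x}"
      using zero_dim_clopenin[OF zd _ p] by blast
    obtain \<C> where "\<C> \<subseteq> \<B>" "\<Union>\<C> = C"
      using \<B> C(1) unfolding is_base_def clopenin_def by blast
    then obtain \<eta> where "\<eta> \<in> K" "p \<in> b \<eta>" "b \<eta> \<subseteq> C"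
      using C(2) b unfolding bij_betw_def by blast
    then show ?thesis
      using some[of \<eta>] C by blast
  qed
  moreover have "U \<eta> \<subseteq> topspace S - {x}" for \<eta>
    using cl[of \<eta>] unfolding clopenin_def using openin_subset by blast
  ultimately have "(\<Union>\<eta>\<in>K. U \<eta>) = topspace S - {x}"
    by blast
  then show ?thesis
    using cl by blast
qed

subsection \<open>Clopen sets attached to the nodes\<close>

text \<open>The node at which the branches through two incomparable nodes split.\<close>

definition is_meet :: "'k rel \<Rightarrow> 'k \<Rightarrow> 'k \<Rightarrow> 'k \<Rightarrow> bool" where
  "is_meet T \<mu> \<eta> \<xi> \<longleftrightarrow> \<eta> \<noteq> \<xi> \<and> (\<eta>, \<xi>) \<notin> T \<and> (\<xi>, \<eta>) \<notin> T \<and> (\<mu>, \<eta>) \<in> T \<and> (\<mu>, \<xi>) \<in> T \<and>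
     (\<forall>\<zeta>. (\<zeta>, \<eta>) \<in> T \<and> (\<zeta>, \<xi>) \<in> T \<longrightarrow> \<zeta> = \<mu> \<or> (\<zeta>, \<mu>) \<in> T)"

lemma is_meet_commute: "is_meet T \<mu> \<eta> \<xi> \<longleftrightarrow> is_meet T \<mu> \<xi> \<eta>"
  by (auto simp: is_meet_def)

text \<open>U will be a clopen cover of the punctured space. The clause on U makes the union along a branch
  locally constant, hence clopen, away from x; the clause on meets makes different branches almost disjoint.\<close>

definition node_set ::
  "'a topology \<Rightarrow> 'k rel \<Rightarrow> 'k rel \<Rightarrow> ('k \<Rightarrow> 'a set) \<Rightarrow> 'a set \<Rightarrow> ('k \<Rightarrow> 'a set) \<Rightarrow> 'k \<Rightarrow> 'a set \<Rightarrow> bool" where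
  "node_set S R T U N h \<xi> B \<longleftrightarrow> clopenin S B \<and> B \<inter> N = {} \<and>
     (\<forall>\<zeta>. (\<zeta>, \<xi>) \<in> T \<longrightarrow> h \<zeta> \<subseteq> B) \<and>
     (\<exists>p\<in>B. \<forall>\<zeta>. (\<zeta>, \<xi>) \<in> T \<longrightarrow> p \<notin> h \<zeta>) \<and>
     (\<forall>\<zeta> \<eta>. (\<zeta>, \<xi>) \<in> T \<and> (\<eta>, \<zeta>) \<in> R \<longrightarrow> B \<inter> U \<eta> \<subseteq> h \<zeta>) \<and>
     (\<forall>\<eta> \<mu>. (\<eta>, \<xi>) \<in> R \<and> is_meet T \<mu> \<eta> \<xi> \<longrightarrow> B \<inter> h \<eta> \<subseteq> h \<mu>)"

text \<open>Well-founded recursion requires that the condition at \<open>\<xi>\<close> depends only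
  on values of \<open>h\<close> at earlier nodes. A meet lies \<open>T\<close>-below
  \<open>\<xi>\<close>, so it is among these as well.\<close>

lemma node_set_cong:
  assumes "T \<subseteq> R" "\<And>z. (z, \<xi>) \<in> R \<Longrightarrow> h z = h' z" and h: "node_set S R T U N h \<xi> B"
  shows "node_set S R T U N h' \<xi> B"
proof -
  have T: "h z = h' z" if "(z, \<xi>) \<in> T" for z
    using assms(1,2) that by blast
  have M: "((\<eta>, \<xi>) \<in> R \<and> is_meet T \<mu> \<eta> \<xi> \<longrightarrow> B \<inter> h \<eta> \<subseteq> h \<mu>) \<longleftrightarrow>
      ((\<eta>, \<xi>) \<in> R \<and> is_meet T \<mu> \<eta> \<xi> \<longrightarrow> B \<inter> h' \<eta> \<subseteq> h' \<mu>)" for \<eta> \<mu>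
    by (cases "(\<eta>, \<xi>) \<in> R \<and> is_meet T \<mu> \<eta> \<xi>") (auto simp: T assms(2) is_meet_def)
  show ?thesis
    using h unfolding node_set_def M by (simp add: T)
qed

context initial_order
begin

text \<open>At stage \<open>\<xi>\<close> the new set must contain \<open>A\<close>, the union over
  the tree predecessors, and avoid \<open>Z1\<close>, \<open>Z2\<close> and \<open>V\<close>. All
  these have small type because their indices are earlier nodes or pairs of them. Once
  \<open>A\<close> is known to be disjoint from what is to be avoided, the guard yields the new
  set.\<close>

lemma node_sets_exist:
  fixes S :: "'a topology" and U :: "'k \<Rightarrow> 'a set"
  assumes TR: "T \<subseteq> R" and trT: "trans T"
    and lin: "\<And>a b c. \<lbrakk>(a, c) \<in> T; (b, c) \<in> T; a \<noteq> b\<rbrakk> \<Longrightarrow> (a, b) \<in> T \<or> (b, a) \<in> T"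
    and U: "\<And>\<eta>. \<eta> \<in> K \<Longrightarrow> clopenin S (U \<eta>) \<and> x \<notin> U \<eta>"
    and V: "separation_guard S K x V"
  shows "\<exists>B. \<forall>\<xi>\<in>K. node_set S R T U (insert x V) B \<xi> (B \<xi>)"
proof -
  let ?N = "insert x V"
  let ?P = "\<lambda>h \<xi> B. \<xi> \<in> K \<longrightarrow> node_set S R T U ?N h \<xi> B"
  have "\<exists>h. \<forall>\<xi>. ?P h \<xi> (h \<xi>)"
  proof (rule dependent_wf_choice[OF wf_R])
    show "?P h \<xi> B = ?P h' \<xi> B" if "\<And>z. (z, \<xi>) \<in> R \<Longrightarrow> h z = h' z" for h h' :: "'k \<Rightarrow> 'a set" and \<xi> B
      using node_set_cong[OF TR, of \<xi> h h'] node_set_cong[OF TR, of \<xi> h' h] that by (metis (no_types))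
    show "\<exists>B. ?P h \<xi> B" if prev: "\<And>z. (z, \<xi>) \<in> R \<Longrightarrow> ?P h z (h z)" for h \<xi>
    proof (cases "\<xi> \<in> K")
      case True
      have prevR: "node_set S R T U ?N h z (h z)" if "(z, \<xi>) \<in> R" for z
        using prev[OF that] R_in_K(1)[OF that] by simp
      have prevT: "node_set S R T U ?N h z (h z)" if "(z, \<xi>) \<in> T" for z
        using prevR TR that by blast
      have cl: "clopenin S (h z)" "h z \<inter> ?N = {}" if "(z, \<xi>) \<in> R" for z
        using prevR[OF that] by (simp_all add: node_set_def)
      have mono: "h z \<subseteq> h z'" if "(z, z') \<in> T" "(z', \<xi>) \<in> R" for z z'
        using prevR[OF that(2)] that(1) by (simp add: node_set_def)
      let ?J = "{\<eta>. (\<eta>, \<xi>) \<in> R}"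
      define I where "I = {\<zeta>. (\<zeta>, \<xi>) \<in> T}"
      define I1 where "I1 = {(\<eta>, \<mu>). (\<eta>, \<xi>) \<in> R \<and> is_meet T \<mu> \<eta> \<xi>}"
      define I2 where "I2 = {(\<zeta>, \<eta>). (\<zeta>, \<xi>) \<in> T \<and> (\<eta>, \<zeta>) \<in> R}"
      define A where "A = (\<Union>\<zeta>\<in>I. h \<zeta>)"
      \<comment> \<open>Avoiding \<open>Z1\<close> amounts to the clause on meets, and avoiding
        \<open>Z2\<close> to the clause on \<open>U\<close>.\<close>
      define Z1 where "Z1 = (\<Union>q\<in>I1. h (fst q) - h (snd q))"
      define Z2 where "Z2 = (\<Union>q\<in>I2. U (snd q) - h (fst q))"
      have J: "?J \<prec> K" "?J \<times> ?J \<prec> K"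
        using small_R[OF True] Times_lesspoll_infinite[OF infinite_K] by auto
      have sub: "I \<subseteq> ?J" "I1 \<subseteq> ?J \<times> ?J" "I2 \<subseteq> ?J \<times> ?J"
        using TR R_trans by (auto simp: I_def I1_def I2_def is_meet_def)
      have tA: "type_less S A K"
        unfolding A_def
        by (rule type_less_UN[OF subset_lesspoll[OF J(1) sub(1)]]) (use sub(1) cl in auto)
      have t1: "type_less S Z1 K"
        unfolding Z1_def
        by (rule type_less_UN[OF subset_lesspoll[OF J(2) sub(2)]]) (use sub(2) cl in \<open>auto intro!: clopenin_Diff\<close>)
      have t2: "type_less S Z2 K"
        unfolding Z2_def
        by (rule type_less_UN[OF subset_lesspoll[OF J(2) sub(3)]]) (use sub(3) cl U R_in_K in \<open>auto intro!: clopenin_Diff\<close>)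
      have tZ: "type_less S (Z1 \<union> Z2 \<union> V) K"
        using V by (intro type_less_Un infinite_K t1 t2) (simp add: separation_guard_def)
      have dV: "A \<inter> V = {}"
        using sub(1) cl(2) unfolding A_def by blast
      have d1: "A \<inter> Z1 = {}"
      proof -
        \<comment> \<open>If \<zeta> is below \<eta>, it is a common predecessor of \<eta> and
          \<xi>, so it is at most the meet and monotonicity suffices. Otherwise \<zeta> and \<eta>
          are incomparable with the same meet, and the clause already holds at whichever of the two
          has the later code.\<close>
        have "h \<zeta> \<inter> h \<eta> \<subseteq> h \<mu>" if \<zeta>: "(\<zeta>, \<xi>) \<in> T" and \<eta>: "(\<eta>, \<xi>) \<in> R" and m: "is_meet T \<mu> \<eta> \<xi>" for \<zeta> \<eta> \<mu>
        proof (cases "(\<zeta>, \<eta>) \<in> T")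
          case True
          then have "\<zeta> = \<mu> \<or> (\<zeta>, \<mu>) \<in> T"
            using m \<zeta> by (simp add: is_meet_def)
          moreover have "(\<mu>, \<xi>) \<in> R"
            using m TR by (auto simp: is_meet_def)
          ultimately show ?thesis
            using mono by blast
        next
          case False
          have ne: "\<zeta> \<noteq> \<eta>" "(\<eta>, \<zeta>) \<notin> T"
            using m \<zeta> transD[OF trT] by (auto simp: is_meet_def)
          \<comment> \<open>Both lie below \<xi> and are therefore comparable; \<zeta> at or below
            \<mu> would put \<zeta> below \<eta>.\<close>
          have "(\<mu>, \<zeta>) \<in> T"
            using lin[of \<mu> \<xi> \<zeta>] m \<zeta> False transD[OF trT] by (auto simp: is_meet_def)
          then have m': "is_meet T \<mu> \<eta> \<zeta>"
            using m \<zeta> ne False transD[OF trT] by (auto simp: is_meet_def)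
          have \<zeta>R: "(\<zeta>, \<xi>) \<in> R"
            using TR \<zeta> by blast
          consider "(\<eta>, \<zeta>) \<in> R" | "(\<zeta>, \<eta>) \<in> R"
            using total_R[of \<eta> \<zeta>] R_in_K \<eta> \<zeta>R ne(1) by blast
          then show ?thesis
          proof cases
            case 1
            then show ?thesis
              using prevR[OF \<zeta>R] m' unfolding node_set_def by blast
          next
            case 2
            then have "h \<eta> \<inter> h \<zeta> \<subseteq> h \<mu>"
              using prevR[OF \<eta>] m' is_meet_commute[of T \<mu> \<eta> \<zeta>] unfolding node_set_def by blast
            then show ?thesis by blast
          qed
        qed
        then have meet: "p \<in> h \<mu>"
          if "(\<zeta>, \<xi>) \<in> T" "(\<eta>, \<xi>) \<in> R" "is_meet T \<mu> \<eta> \<xi>" "p \<in> h \<zeta>" "p \<in> h \<eta>" for p \<zeta> \<eta> \<mu>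
          using that by blast
        show ?thesis
          by (auto simp: A_def Z1_def I_def I1_def dest: meet)
      qed
      have d2: "A \<inter> Z2 = {}"
      proof -
        \<comment> \<open>Both nodes lie on the chain below \<xi>: if \<zeta>' comes first this is
          monotonicity, and if it comes later it is the clause on \<open>U\<close> at
          \<zeta>'.\<close>
        have "h \<zeta>' \<inter> U \<eta> \<subseteq> h \<zeta>" if \<zeta>': "(\<zeta>', \<xi>) \<in> T" and \<zeta>: "(\<zeta>, \<xi>) \<in> T" and \<eta>: "(\<eta>, \<zeta>) \<in> R" for \<zeta> \<zeta>' \<eta>
        proof -
          consider "\<zeta>' = \<zeta>" | "(\<zeta>', \<zeta>) \<in> T" | "(\<zeta>, \<zeta>') \<in> T"
            using lin[OF \<zeta>' \<zeta>] by blast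
          then show ?thesis
          proof cases
            case 2
            then show ?thesis
              using mono[of \<zeta>' \<zeta>] \<zeta> TR by blast
          next
            case 3
            then show ?thesis
              using prevT[OF \<zeta>'] \<eta> unfolding node_set_def by blast
          qed blast
        qed
        then have below: "p \<in> h \<zeta>"
          if "(\<zeta>', \<xi>) \<in> T" "(\<zeta>, \<xi>) \<in> T" "(\<eta>, \<zeta>) \<in> R" "p \<in> h \<zeta>'" "p \<in> U \<eta>" for p \<zeta> \<zeta>' \<eta>
          using that by blast
        show ?thesis
          by (auto simp: A_def Z2_def I_def I2_def dest: below)
      qed
      have xA: "x \<notin> A"
        using sub(1) cl(2) unfolding A_def by blast
      have "x \<notin> Z1"
      proof
        assume "x \<in> Z1"
        then obtain \<eta> where "(\<eta>, \<xi>) \<in> R" "x \<in> h \<eta>"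
          by (auto simp: Z1_def I1_def)
        then show False
          using cl(2)[of \<eta>] by blast
      qed
      moreover have "x \<notin> Z2"
      proof
        assume "x \<in> Z2"
        then obtain \<eta> \<zeta> where "(\<eta>, \<zeta>) \<in> R" "x \<in> U \<eta>"
          by (auto simp: Z2_def I2_def)
        then show False
          using U[of \<eta>] R_in_K(1)[of \<eta> \<zeta>] by blast
      qed
      ultimately have xZ: "x \<notin> Z1 \<union> Z2 \<union> V"
        using V by (simp add: separation_guard_def)
      have "A \<inter> (Z1 \<union> Z2 \<union> V) = {}"
        using dV d1 d2 by blast
      then obtain B where B: "clopenin S B" "x \<notin> B" "A \<subseteq> B" "B \<inter> (Z1 \<union> Z2 \<union> V) = {}" "\<not> B \<subseteq> A"
        using V tA tZ xA xZ unfolding separation_guard_def by (metis Un_upper2)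
      have "node_set S R T U ?N h \<xi> B"
        unfolding node_set_def
      proof (intro conjI allI impI)
        show "clopenin S B" by (fact B(1))
        show "B \<inter> ?N = {}" using B(2,4) by blast
        show "h \<zeta> \<subseteq> B" if "(\<zeta>, \<xi>) \<in> T" for \<zeta>
          using that B(3) unfolding A_def I_def by blast
        show "\<exists>p\<in>B. \<forall>\<zeta>. (\<zeta>, \<xi>) \<in> T \<longrightarrow> p \<notin> h \<zeta>"
          using B(5) unfolding A_def I_def by blast
        show "B \<inter> U \<eta> \<subseteq> h \<zeta>" if "(\<zeta>, \<xi>) \<in> T \<and> (\<eta>, \<zeta>) \<in> R" for \<zeta> \<eta>
        proof -
          have "(\<zeta>, \<eta>) \<in> I2"
            using that by (simp add: I2_def)
          then have "U \<eta> - h \<zeta> \<subseteq> Z2"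
            unfolding Z2_def by force
          then show ?thesis
            using B(4) by blast
        qed
        show "B \<inter> h \<eta> \<subseteq> h \<mu>" if "(\<eta>, \<xi>) \<in> R \<and> is_meet T \<mu> \<eta> \<xi>" for \<eta> \<mu>
        proof -
          have "(\<eta>, \<mu>) \<in> I1"
            using that by (simp add: I1_def)
          then have "h \<eta> - h \<mu> \<subseteq> Z1"
            unfolding Z1_def by force
          then show ?thesis
            using B(4) by blast
        qed
      qed
      then show ?thesis by blast
    qed simp
  qed
  then show ?thesis
    by blast
qed

end

subsection \<open>Branches\<close>

context initial_order
begin

text \<open>An injective image of \<open>K\<close> is too large for an initial segment.\<close>

lemma R_unbounded:
  assumes "inj_on h K" "h ` K \<subseteq> K" "\<eta> \<in> K"
  shows "\<exists>a\<in>K. (\<eta>, h a) \<in> R"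
proof (rule ccontr)
  assume no: "\<not> ?thesis"
  have "h ` K \<subseteq> insert \<eta> {b. (b, \<eta>) \<in> R}"
  proof (rule image_subsetI)
    fix a assume a: "a \<in> K"
    then have "h a \<in> K" "(\<eta>, h a) \<notin> R"
      using assms(2) no by auto
    then show "h a \<in> insert \<eta> {b. (b, \<eta>) \<in> R}"
      using total_R[of "h a" \<eta>] assms(3) by blast
  qed
  then have "h ` K \<prec> K"
    by (rule subset_lesspoll[OF small_Req[OF assms(3)]])
  then show False
    using assms(1) by simp
qed

end

section \<open>The tree order on codes\<close>

context coded_tree
begin

definition tree_rel :: "'a rel" where
  "tree_rel = {p. \<exists>f a b. (a, b) \<in> R \<and> p = (e f a, e f b)}"

lemma tree_relI: "(a, b) \<in> R \<Longrightarrow> (e f a, e f b) \<in> tree_rel"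
  by (auto simp: tree_rel_def)

text \<open>The code of a node determines \<open>f\<close> below its level, so every predecessor can
  be written with the same \<open>f\<close>. Transitivity and linearity below a node thus reduce to
  comparing levels.\<close>

lemma tree_rel_pred:
  assumes "(\<eta>, e f b) \<in> tree_rel" "b \<in> K"
  obtains a where "(a, b) \<in> R" "\<eta> = e f a"
proof -
  obtain g a c where g: "(a, c) \<in> R" "\<eta> = e g a" "e f b = e g c"
    using assms(1) by (auto simp: tree_rel_def)
  have bc: "b = c" "\<And>d. (d, b) \<in> R \<Longrightarrow> d \<in> f \<longleftrightarrow> d \<in> g"
    using code_eqD[OF assms(2) R_in_K(2)[OF g(1)] g(3)] by auto
  have "e g a = e f a"
    by (rule code_cong) (use bc R_trans[OF _ g(1)] in auto)
  then show ?thesis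
    using that[of a] g bc(1) by simp
qed

lemma tree_rel_node:
  assumes "(\<eta>, \<xi>) \<in> tree_rel"
  obtains f b where "b \<in> K" "\<xi> = e f b"
proof -
  obtain f a b where "(a, b) \<in> R" "\<xi> = e f b"
    using assms by (auto simp: tree_rel_def)
  then show ?thesis
    using that[OF R_in_K(2)] by simp
qed

lemma tree_rel_subset: "tree_rel \<subseteq> R"
  using code_mono by (auto simp: tree_rel_def)

lemma trans_tree_rel: "trans tree_rel"
proof (rule transI)
  fix a b c assume ab: "(a, b) \<in> tree_rel" and bc: "(b, c) \<in> tree_rel"
  obtain f c' where c: "c' \<in> K" "c = e f c'"
    using tree_rel_node[OF bc] .
  obtain b' where b: "(b', c') \<in> R" "b = e f b'"
    using tree_rel_pred[OF bc[unfolded c(2)] c(1)] .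
  obtain a' where a: "(a', b') \<in> R" "a = e f a'"
    using tree_rel_pred[OF ab[unfolded b(2)] R_in_K(1)[OF b(1)]] .
  show "(a, c) \<in> tree_rel"
    unfolding a(2) c(2) by (rule tree_relI[OF R_trans[OF a(1) b(1)]])
qed

lemma tree_rel_linear:
  assumes ac: "(a, c) \<in> tree_rel" and bc: "(b, c) \<in> tree_rel" and ne: "a \<noteq> b"
  shows "(a, b) \<in> tree_rel \<or> (b, a) \<in> tree_rel"
proof -
  obtain f c' where c: "c' \<in> K" "c = e f c'"
    using tree_rel_node[OF bc] .
  obtain b' where b: "(b', c') \<in> R" "b = e f b'"
    using tree_rel_pred[OF bc[unfolded c(2)] c(1)] .
  obtain a' where a: "(a', c') \<in> R" "a = e f a'"
    using tree_rel_pred[OF ac[unfolded c(2)] c(1)] .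
  have "(a', b') \<in> R \<or> (b', a') \<in> R"
    using total_R[OF R_in_K(1)[OF a(1)] R_in_K(1)[OF b(1)]] ne a(2) b(2) by auto
  then show ?thesis
    unfolding a(2) b(2) by (blast intro: tree_relI)
qed

lemma code_unbounded: "\<eta> \<in> K \<Longrightarrow> \<exists>a\<in>K. (\<eta>, e f a) \<in> R"
proof (rule R_unbounded[of "e f"])
  show "inj_on (e f) K"
    by (rule inj_onI, rule conjunct1[OF code_eqD])
  show "e f ` K \<subseteq> K"
    by (rule image_subsetI[OF code_in_K])
qed

text \<open>Let \<open>d\<close> be the first difference of the branches \<open>f\<close> and
  \<open>g\<close>. Codes above level \<open>d\<close> record membership of \<open>d\<close>, which
  makes the two nodes incomparable; a common predecessor sees no difference, so its level is at most
  \<open>d\<close>.\<close>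

lemma is_meet_code:
  assumes d: "(d \<in> f) \<noteq> (d \<in> g)" and agree: "\<And>c. (c, d) \<in> R \<Longrightarrow> c \<in> f \<longleftrightarrow> c \<in> g"
    and a: "(d, a) \<in> R" and c: "(d, c) \<in> R"
  shows "is_meet tree_rel (e f d) (e g c) (e f a)"
  unfolding is_meet_def
proof (intro conjI allI impI)
  \<comment> \<open>A node at level \<open>d\<close> knows its branch strictly below
    \<open>d\<close> only, so at level \<open>d\<close> itself the branches still agree.\<close>
  have ed: "e f d = e g d"
    by (rule code_cong[OF agree])
  have dK: "d \<in> K"
    using R_in_K(1)[OF a] .
  have K': "a \<in> K" "c \<in> K"
    using R_in_K(2)[OF a] R_in_K(2)[OF c] .
  show "e g c \<noteq> e f a"
    using code_eqD[OF K'(2,1)] d c by blast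
  show "(e g c, e f a) \<notin> tree_rel"
  proof
    assume t: "(e g c, e f a) \<in> tree_rel"
    obtain b where b: "(b, a) \<in> R" "e g c = e f b"
      using tree_rel_pred[OF t K'(1)] .
    then show False
      using code_eqD[OF K'(2) R_in_K(1)[OF b(1)] b(2)] d c by blast
  qed
  show "(e f a, e g c) \<notin> tree_rel"
  proof
    assume t: "(e f a, e g c) \<in> tree_rel"
    obtain b where b: "(b, c) \<in> R" "e f a = e g b"
      using tree_rel_pred[OF t K'(2)] .
    then show False
      using code_eqD[OF K'(1) R_in_K(1)[OF b(1)] b(2)] d a by blast
  qed
  show "(e f d, e g c) \<in> tree_rel"
    unfolding ed by (rule tree_relI[OF c])
  show "(e f d, e f a) \<in> tree_rel"
    by (rule tree_relI[OF a])
  fix \<zeta> assume \<zeta>: "(\<zeta>, e g c) \<in> tree_rel \<and> (\<zeta>, e f a) \<in> tree_rel"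
  obtain b where b: "(b, a) \<in> R" "\<zeta> = e f b"
    using tree_rel_pred[OF conjunct2[OF \<zeta>] K'(1)] .
  obtain b' where b': "(b', c) \<in> R" "\<zeta> = e g b'"
    using tree_rel_pred[OF conjunct1[OF \<zeta>] K'(2)] .
  have "\<forall>c. (c, b) \<in> R \<longrightarrow> (c \<in> f \<longleftrightarrow> c \<in> g)"
    using code_eqD[OF R_in_K(1)[OF b(1)] R_in_K(1)[OF b'(1)]] b(2) b'(2) by simp
  then have "(d, b) \<notin> R"
    using d by blast
  then have "b = d \<or> (b, d) \<in> R"
    using total_R[OF R_in_K(1)[OF b(1)] dK] by blast
  then show "\<zeta> = e f d \<or> (\<zeta>, e f d) \<in> tree_rel"
    unfolding b(2) by (blast intro: tree_relI)
qed

end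

section \<open>Unions along branches\<close>

context initial_order
begin

lemma almost_disjoint_clopen_sets:
  fixes S :: "'a topology"
  assumes K: "kappa_eq_kappa_less_kappa K" and S: "parovicenko K S" and w: "weight_eq S K"
    and x: "x \<in> topspace S"
  obtains A :: "'k set \<Rightarrow> 'a set"
  where "\<And>f. clopenin (subtopology S (topspace S - {x})) (A f)"
    and "\<And>f. \<not> compactin S (A f)"
    and "\<And>f g. \<lbrakk>f \<subseteq> K; g \<subseteq> K; f \<noteq> g\<rbrakk> \<Longrightarrow>
      \<exists>C. compactin S C \<and> C \<subseteq> topspace S - {x} \<and> A f \<inter> A g \<subseteq> C"
proof -
  obtain e where "coded_tree K R e"
    using coded_tree_exists[OF K] by blast
  then interpret coded_tree K R e .
  have zd: "zero_dim S" and H: "Hausdorff_space S" and cpt: "compact_space S"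
    using S by (auto simp: parovicenko_def)
  obtain U where "(\<forall>\<eta>\<in>K. clopenin S (U \<eta>) \<and> x \<notin> U \<eta>) \<and> (\<Union>\<eta>\<in>K. U \<eta>) = topspace S - {x}"
    using weight_cover[OF zd H w x] ..
  then have U: "\<And>\<eta>. \<eta> \<in> K \<Longrightarrow> clopenin S (U \<eta>) \<and> x \<notin> U \<eta>"
    and cover: "(\<Union>\<eta>\<in>K. U \<eta>) = topspace S - {x}"
    by simp_all
  obtain V where V: "separation_guard S K x V"
    using separation_guard_exists[OF infinite_K S x] ..
  obtain B where "\<forall>\<xi>\<in>K. node_set S R tree_rel U (insert x V) B \<xi> (B \<xi>)"
    using node_sets_exist[OF tree_rel_subset trans_tree_rel tree_rel_linear U V] ..
  then have B: "\<And>\<xi>. \<xi> \<in> K \<Longrightarrow> node_set S R tree_rel U (insert x V) B \<xi> (B \<xi>)"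
    by simp
  have Bcl: "clopenin S (B \<xi>)" "x \<notin> B \<xi>" if "\<xi> \<in> K" for \<xi>
    using B[OF that] by (auto simp: node_set_def)
  have Bmono: "B (e f a) \<subseteq> B (e f b)" if "(a, b) \<in> R" for f a b
    using B[OF code_in_K[OF R_in_K(2)[OF that]], of f] tree_relI[OF that, of f] by (simp add: node_set_def)
  have Bnew: "\<exists>p\<in>B (e f b). p \<notin> B (e f a)" if "(a, b) \<in> R" for f a b
    using B[OF code_in_K[OF R_in_K(2)[OF that]], of f] tree_relI[OF that, of f] by (auto simp: node_set_def)
  have BU: "B (e f b) \<inter> U \<eta> \<subseteq> B (e f a)" if "(a, b) \<in> R" "(\<eta>, e f a) \<in> R" for f a b \<eta>
    using B[OF code_in_K[OF R_in_K(2)[OF that(1)]], of f] tree_relI[OF that(1), of f] that(2)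
    unfolding node_set_def by simp
  \<comment> \<open>The clause in \<open>node_set\<close> speaks of earlier \<eta> only; totality of
    \<open>R\<close> and symmetry of the meet remove this restriction.\<close>
  have Bmeet: "B \<xi> \<inter> B \<eta> \<subseteq> B \<mu>" if m: "is_meet tree_rel \<mu> \<eta> \<xi>" and K': "\<xi> \<in> K" "\<eta> \<in> K" for \<mu> \<eta> \<xi>
  proof -
    consider "(\<eta>, \<xi>) \<in> R" | "(\<xi>, \<eta>) \<in> R"
      using total_R[OF K'] m by (auto simp: is_meet_def)
    then show ?thesis
    proof cases
      case 1
      then show ?thesis
        using B[OF K'(1)] m by (simp add: node_set_def)
    next
      case 2
      then have "B \<eta> \<inter> B \<xi> \<subseteq> B \<mu>"
        using B[OF K'(2)] m is_meet_commute[of tree_rel \<mu> \<eta> \<xi>] by (simp add: node_set_def)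
      then show ?thesis
        by (simp add: Int_commute)
    qed
  qed
  define A where "A f = (\<Union>a\<in>K. B (e f a))" for f
  \<comment> \<open>Once the code at level \<open>a\<close> has passed \<eta>, the branch adds
    nothing further inside \<open>U \<eta>\<close>. This local constancy is what makes
    \<open>A f\<close> relatively closed.\<close>
  have AU: "A f \<inter> U \<eta> \<subseteq> B (e f a)" if \<eta>: "(\<eta>, e f a) \<in> R" "a \<in> K" for f \<eta> a
  proof -
    have "B (e f b) \<inter> U \<eta> \<subseteq> B (e f a)" if b: "b \<in> K" for b
    proof -
      consider "a = b" | "(a, b) \<in> R" | "(b, a) \<in> R"
        using total_R[OF \<eta>(2) b] by blast
      then show ?thesis
        by cases (use BU[OF _ \<eta>(1)] Bmono in blast)+
    qed
    then show ?thesis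
      unfolding A_def by blast
  qed
  have Asub: "A f \<subseteq> topspace S - {x}" for f
  proof
    fix p assume "p \<in> A f"
    then obtain a where "a \<in> K" "p \<in> B (e f a)"
      by (auto simp: A_def)
    then show "p \<in> topspace S - {x}"
      using Bcl[OF code_in_K, of a f] openin_subset[of S "B (e f a)"] by (auto simp: clopenin_def)
  qed
  show ?thesis
  proof
    fix f g
    have opA: "openin S (A f)"
      unfolding A_def using Bcl(1)[OF code_in_K] by (auto simp: clopenin_def)
    have "openin S (topspace S - {x} - A f)"
    proof (subst openin_subopen, intro ballI)
      fix p assume p: "p \<in> topspace S - {x} - A f"
      then have "p \<in> (\<Union>\<eta>\<in>K. U \<eta>)"
        by (simp add: cover)
      then obtain \<eta> where \<eta>: "\<eta> \<in> K" "p \<in> U \<eta>"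
        by blast
      obtain a where a: "a \<in> K" "(\<eta>, e f a) \<in> R"
        using code_unbounded[OF \<eta>(1)] by blast
      have "openin S (U \<eta> - B (e f a))"
        using U[OF \<eta>(1)] Bcl(1)[OF code_in_K[OF a(1)], of f] by (simp add: clopenin_def openin_diff)
      moreover have "p \<in> U \<eta> - B (e f a)"
        using p \<eta>(2) a(1) by (auto simp: A_def)
      moreover have "U \<eta> - B (e f a) \<subseteq> topspace S - {x} - A f"
        using AU[OF a(2,1)] cover \<eta>(1) by blast
      ultimately show "\<exists>W. openin S W \<and> p \<in> W \<and> W \<subseteq> topspace S - {x} - A f"
        by (intro exI conjI)
    qed
    \<comment> \<open>The closed set here is \<open>A f\<close> together with \<open>x\<close>; its
      trace on the punctured space is \<open>A f\<close>.\<close>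
    then have c: "closedin S (topspace S - (topspace S - {x} - A f))"
      by (rule closedin_diff[OF closedin_topspace])
    show "clopenin (subtopology S (topspace S - {x})) (A f)"
      unfolding clopenin_def
    proof (intro conjI)
      show "openin (subtopology S (topspace S - {x})) (A f)"
        using opA Asub[of f] by (auto simp: openin_subtopology intro!: exI[of _ "A f"])
      have "A f = (topspace S - (topspace S - {x} - A f)) \<inter> (topspace S - {x})"
        using Asub[of f] by blast
      then show "closedin (subtopology S (topspace S - {x})) (A f)"
        unfolding closedin_subtopology using c by blast
    qed
    show "\<not> compactin S (A f)"
    proof
      assume "compactin S (A f)"
      moreover have "\<forall>W\<in>U ` K. openin S W"
        using U by (simp add: clopenin_def)
      moreover have "A f \<subseteq> \<Union>(U ` K)"
        using Asub[of f] cover by simp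
      ultimately obtain \<F> where "finite \<F>" "\<F> \<subseteq> U ` K" "A f \<subseteq> \<Union>\<F>"
        unfolding compactin_def by blast
      then obtain F where F: "finite F" "F \<subseteq> K" "A f \<subseteq> (\<Union>\<eta>\<in>F. U \<eta>)"
        by (metis finite_subset_image)
      \<comment> \<open>If finitely many \<open>U \<eta>\<close> covered \<open>A f\<close>, the
        branch would stop growing beyond a bound of their indices, but each later node contributes a
        new point.\<close>
      obtain \<theta> where \<theta>: "\<theta> \<in> K" "\<forall>\<eta>\<in>F. (\<eta>, \<theta>) \<in> R"
        using small_bounded[OF K F(2) finite_lesspoll_infinite[OF infinite_K F(1)]] by blast
      obtain a where a: "a \<in> K" "(\<theta>, e f a) \<in> R"
        using code_unbounded[OF \<theta>(1)] by blast
      obtain b where b: "(a, b) \<in> R"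
        using R_unbounded[of id a] a(1) by auto
      obtain p where p: "p \<in> B (e f b)" "p \<notin> B (e f a)"
        using Bnew[OF b] by blast
      have "p \<in> A f"
        unfolding A_def using p(1) R_in_K(2)[OF b] by blast
      then obtain \<eta> where \<eta>: "\<eta> \<in> F" "p \<in> U \<eta>"
        using F(3) by blast
      have "(\<eta>, e f a) \<in> R"
        using \<theta>(2) \<eta>(1) a(2) R_trans by blast
      then show False
        using BU[OF b] p \<eta>(2) by blast
    qed
    assume fg: "f \<subseteq> K" "g \<subseteq> K" "f \<noteq> g"
    then obtain d0 where "d0 \<in> {d. (d \<in> f) \<noteq> (d \<in> g)}"
      by blast
    then obtain d where "d \<in> {d. (d \<in> f) \<noteq> (d \<in> g)}"
      and "\<And>c. (c, d) \<in> R \<Longrightarrow> c \<notin> {d. (d \<in> f) \<noteq> (d \<in> g)}"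
      by (rule wfE_min[OF wf_R]) (rule that)
    then have d: "(d \<in> f) \<noteq> (d \<in> g)" and agree: "\<And>c. (c, d) \<in> R \<Longrightarrow> c \<in> f \<longleftrightarrow> c \<in> g"
      by blast+
    have dK: "d \<in> K"
      using d fg by blast
    have ed: "e f d = e g d"
      by (rule code_cong[OF agree])
    have "A f \<inter> A g \<subseteq> B (e f d)"
    proof
      fix p assume "p \<in> A f \<inter> A g"
      then obtain a c where ac: "a \<in> K" "p \<in> B (e f a)" "c \<in> K" "p \<in> B (e g c)"
        by (auto simp: A_def)
      have low: "p \<in> B (e h d)" if "p \<in> B (e h b)" "b = d \<or> (b, d) \<in> R" for h b
        using that Bmono[of b d h] by blast
      \<comment> \<open>If one of the two nodes is at level \<open>d\<close> or lower, monotonicity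
        moves \<open>p\<close> up to level \<open>d\<close>. If both are higher, their meet is the
        common node at level \<open>d\<close>.\<close>
      consider "a = d \<or> (a, d) \<in> R" | "c = d \<or> (c, d) \<in> R" | "(d, a) \<in> R" "(d, c) \<in> R"
        using total_R[OF ac(1) dK] total_R[OF ac(3) dK] by blast
      then show "p \<in> B (e f d)"
      proof cases
        case 1
        then show ?thesis
          using low[OF ac(2)] by simp
      next
        case 2
        then show ?thesis
          using low[OF ac(4)] ed by simp
      next
        case 3
        then show ?thesis
          using Bmeet[OF is_meet_code[OF d agree 3] code_in_K[OF ac(1)] code_in_K[OF ac(3)]] ac(2,4) by blast
      qed
    qed
    moreover have "compactin S (B (e f d))"
      using Bcl(1)[OF code_in_K[OF dK]] by (simp add: clopenin_def closedin_compact_space[OF cpt])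
    moreover have "B (e f d) \<subseteq> topspace S - {x}"
      using compactin_subset_topspace[OF \<open>compactin S (B (e f d))\<close>] Bcl(2)[OF code_in_K[OF dK]] by blast
    ultimately show "\<exists>C. compactin S C \<and> C \<subseteq> topspace S - {x} \<and> A f \<inter> A g \<subseteq> C"
      by (intro exI conjI)
  qed
qed

end

subsection \<open>The remainder\<close>

text \<open>By density the extension \<open>g\<close> of the indicator of \<open>A\<close> takes
  only the values 0 and 1. The closed set where \<open>g\<close> is 1 then equals the open set where
  \<open>g\<close> is positive.\<close>

lemma stone_cech_clopen_extension:
  assumes Y: "stone_cech X Y e" and A: "clopenin X A"
  shows "\<exists>E. clopenin Y E \<and> (\<forall>p\<in>topspace X. e p \<in> E \<longleftrightarrow> p \<in> A)"
proof -
  let ?i = "\<lambda>p. if p \<in> A then 1 else 0 :: real"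
  have "bounded (?i ` topspace X)"
    by (rule bounded_subset[of "{0, 1}"]) auto
  then have "\<exists>g. continuous_map Y euclideanreal g \<and> (\<forall>p\<in>topspace X. g (e p) = ?i p)"
    using Y continuous_map_indicator[OF A] by (simp add: stone_cech_def)
  then obtain g where g: "continuous_map Y euclideanreal g" "\<And>p. p \<in> topspace X \<Longrightarrow> g (e p) = ?i p"
    by blast
  have "closedin Y {y \<in> topspace Y. g y \<in> {0, 1}}"
    by (rule closedin_continuous_map_preimage[OF g(1)]) simp
  then have "Y closure_of (e ` topspace X) \<subseteq> {y \<in> topspace Y. g y \<in> {0, 1}}"
  proof (rule closure_of_minimal[rotated])
    have "e ` topspace X \<subseteq> topspace Y"
      using Y embedding_map_in_subtopology[of X Y "topspace Y" e] by (simp add: stone_cech_def)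
    then show "e ` topspace X \<subseteq> {y \<in> topspace Y. g y \<in> {0, 1}}"
      using g(2) by auto
  qed
  then have g01: "g y = 0 \<or> g y = 1" if "y \<in> topspace Y" for y
    using Y that by (auto simp: stone_cech_def)
  let ?E = "{y \<in> topspace Y. g y \<in> {1}}"
  have "closedin Y ?E"
    by (rule closedin_continuous_map_preimage[OF g(1)]) simp
  moreover have "openin Y {y \<in> topspace Y. g y \<in> {0<..}}"
    by (rule openin_continuous_map_preimage[OF g(1)]) simp
  moreover have "{y \<in> topspace Y. g y \<in> {0<..}} = ?E"
    using g01 by force
  ultimately have "clopenin Y ?E"
    by (simp only: clopenin_def)
  moreover have "e p \<in> ?E \<longleftrightarrow> p \<in> A" if "p \<in> topspace X" for p
  proof -
    have "e p \<in> topspace Y"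
      using Y embedding_map_in_subtopology[of X Y "topspace Y" e] that by (auto simp: stone_cech_def)
    then show ?thesis
      using g(2)[OF that] by simp
  qed
  ultimately show ?thesis
    by blast
qed

text \<open>The clopen extensions \<open>E i\<close> are cut down to the remainder. An empty trace
  would make \<open>A i\<close> compact. For distinct indices, density confines the overlap of the
  extensions to the image of a compact set, which lies outside the remainder.\<close>

lemma remainder_disjoint_clopen_sets:
  fixes I :: "'i set" and A :: "'i \<Rightarrow> 'a set"
  assumes Y: "stone_cech X Y e"
    and A: "\<And>i. i \<in> I \<Longrightarrow> clopenin X (A i)" "\<And>i. i \<in> I \<Longrightarrow> \<not> compactin X (A i)"
    and AD: "\<And>i j. \<lbrakk>i \<in> I; j \<in> I; i \<noteq> j\<rbrakk> \<Longrightarrow> \<exists>C. compactin X C \<and> A i \<inter> A j \<subseteq> C"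
  shows "\<exists>\<C>. \<C> \<approx> I \<and> (\<forall>C\<in>\<C>. C \<noteq> {} \<and> openin (remainder X Y e) C \<and> closedin (remainder X Y e) C) \<and>
    pairwise disjnt \<C>"
proof -
  have cpt: "compact_space Y" and H: "Hausdorff_space Y" and emb: "embedding_map X Y e"
    and dense: "Y closure_of (e ` topspace X) = topspace Y"
    using Y by (auto simp: stone_cech_def)
  have hom: "homeomorphic_map X (subtopology Y (e ` topspace X)) e"
    using emb by (simp add: embedding_map_def)
  have compact_iff: "compactin X C \<longleftrightarrow> compactin Y (e ` C)" if "C \<subseteq> topspace X" for C
    using homeomorphic_map_compactness[OF hom that] that
    by (simp add: compactin_subtopology image_mono)
  have "\<exists>E. \<forall>i\<in>I. clopenin Y (E i) \<and> (\<forall>p\<in>topspace X. e p \<in> E i \<longleftrightarrow> p \<in> A i)"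
    by (rule bchoice) (use stone_cech_clopen_extension[OF Y A(1)] in blast)
  then obtain E where "\<forall>i\<in>I. clopenin Y (E i) \<and> (\<forall>p\<in>topspace X. e p \<in> E i \<longleftrightarrow> p \<in> A i)" ..
  then have E: "\<And>i. i \<in> I \<Longrightarrow> clopenin Y (E i)"
    and EA: "\<And>i p. \<lbrakk>i \<in> I; p \<in> topspace X\<rbrakk> \<Longrightarrow> e p \<in> E i \<longleftrightarrow> p \<in> A i"
    by simp_all
  define M where "M i = E i \<inter> (topspace Y - e ` topspace X)" for i
  have open_closed: "openin (remainder X Y e) (M i) \<and> closedin (remainder X Y e) (M i)" if "i \<in> I" for i
    using E[OF that] closedin_subtopology_Int_closed[of Y "E i" "topspace Y - e ` topspace X"]
    unfolding M_def remainder_def clopenin_def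
    by (simp add: openin_subtopology_Int Int_commute)
  have nonempty: "M i \<noteq> {}" if i: "i \<in> I" for i
  proof
    assume "M i = {}"
    moreover have "E i \<subseteq> topspace Y"
      using E[OF i] by (simp add: clopenin_def openin_subset)
    ultimately have "E i \<subseteq> e ` topspace X"
      unfolding M_def by blast
    have AX: "A i \<subseteq> topspace X"
      using A(1)[OF i] by (simp add: clopenin_def openin_subset)
    have "E i = e ` A i"
    proof
      show "E i \<subseteq> e ` A i"
        using \<open>E i \<subseteq> e ` topspace X\<close> EA[OF i] by blast
      show "e ` A i \<subseteq> E i"
        using AX EA[OF i] by blast
    qed
    moreover have "compactin Y (E i)"
      using E[OF i] by (simp add: clopenin_def closedin_compact_space[OF cpt])
    ultimately show False
      using A(2)[OF i] compact_iff[OF AX] by simp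
  qed
  have disjoint: "M i \<inter> M j = {}" if ij: "i \<in> I" "j \<in> I" "i \<noteq> j" for i j
  proof -
    obtain C where C: "compactin X C" "A i \<inter> A j \<subseteq> C"
      using AD[OF ij] by blast
    have CX: "C \<subseteq> topspace X"
      by (rule compactin_subset_topspace[OF C(1)])
    have "closedin Y (e ` C)"
      using compactin_imp_closedin[OF H] compact_iff[OF CX] C(1) by simp
    \<comment> \<open>The image of \<open>C\<close> is compact, hence closed in the Hausdorff space
      \<open>Y\<close>. The resulting open set misses the dense image of \<open>X\<close> and must
      be empty.\<close>
    then have "openin Y (E i \<inter> E j - e ` C)"
      using E[OF ij(1)] E[OF ij(2)] by (simp add: clopenin_def openin_diff openin_Int)
    moreover have "e ` topspace X \<inter> (E i \<inter> E j - e ` C) = {}"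
    proof (rule ccontr)
      assume "e ` topspace X \<inter> (E i \<inter> E j - e ` C) \<noteq> {}"
      then obtain p where p: "p \<in> topspace X" "e p \<in> E i" "e p \<in> E j" "e p \<notin> e ` C"
        by blast
      then have "p \<in> A i \<inter> A j"
        using EA ij by simp
      then show False
        using C(2) p(4) by blast
    qed
    ultimately have "E i \<inter> E j - e ` C = {}"
      using dense unfolding dense_intersects_open by blast
    then show ?thesis
      using CX unfolding M_def by blast
  qed
  have "inj_on M I"
  proof (rule inj_onI, rule ccontr)
    fix i j assume "i \<in> I" "j \<in> I" "M i = M j" "i \<noteq> j"
    then show False
      using disjoint[of i j] nonempty[of i] by simp
  qed
  then have "M ` I \<approx> I"
    by (rule inj_on_image_eqpoll_self)
  moreover have "pairwise disjnt (M ` I)"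
    unfolding pairwise_def disjnt_def using disjoint by auto
  ultimately show ?thesis
    using open_closed nonempty by (intro exI[of _ "M ` I"]) simp
qed

theorem theorem7p5:
  fixes K :: "'k set" and S :: "'a topology" and x :: 'a
    and Y :: "'b topology" and e :: "'a \<Rightarrow> 'b"
  assumes "infinite K"
    and "kappa_eq_kappa_less_kappa K"
    and "parovicenko K S" and "weight_eq S K"
    and "x \<in> topspace S"
    and "stone_cech (subtopology S (topspace S - {x})) Y e"
  shows "\<exists>\<C>. \<C> \<approx> Pow K \<and>
           (\<forall>C\<in>\<C>. C \<noteq> {} \<and>
              openin (remainder (subtopology S (topspace S - {x})) Y e) C \<and>
              closedin (remainder (subtopology S (topspace S - {x})) Y e) C) \<and>
           pairwise disjnt \<C>"
proof -
  obtain R where "initial_order K R"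
    using initial_order_exists[OF assms(1)] ..
  then interpret initial_order K R .
  show ?thesis
  proof (rule almost_disjoint_clopen_sets[OF assms(2-5)])
    fix A :: "'k set \<Rightarrow> 'a set"
    assume A: "\<And>f. clopenin (subtopology S (topspace S - {x})) (A f)" "\<And>f. \<not> compactin S (A f)"
      and AD: "\<And>f g. \<lbrakk>f \<subseteq> K; g \<subseteq> K; f \<noteq> g\<rbrakk> \<Longrightarrow>
        \<exists>C. compactin S C \<and> C \<subseteq> topspace S - {x} \<and> A f \<inter> A g \<subseteq> C"
    show ?thesis
    \<comment> \<open>Branches are indexed by the subsets of \<open>K\<close>, which yields 2^kappa
      sets. Compactness in the punctured space agrees with compactness in \<open>S\<close> for sets
      missing \<open>x\<close>.\<close>
    proof (rule remainder_disjoint_clopen_sets[OF assms(6), of "Pow K" A])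
      show "clopenin (subtopology S (topspace S - {x})) (A f)" for f
        by (rule A(1))
      show "\<not> compactin (subtopology S (topspace S - {x})) (A f)" for f
        using A(2)[of f] by (simp add: compactin_subtopology)
      show "\<exists>C. compactin (subtopology S (topspace S - {x})) C \<and> A f \<inter> A g \<subseteq> C"
        if "f \<in> Pow K" "g \<in> Pow K" "f \<noteq> g" for f g
        using AD[of f g] that by (auto simp: compactin_subtopology)
    qed
  qed
qed

end
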